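(* Let $K$ be a field complete with respect to a discrete non-archimedean valuation $v$, with uniformizer $\pi$ and residue field $k$. Let $F$ be a system of $n$ nonzero polynomials in $K[X_1^{\pm1},\ldots,X_n^{\pm1}]$. Let $w\in\mathrm{Trop}(F)\cap v(\pi)\mathbb{Z}^n$ and suppose that $F$ is semiregular at $w$. Then the first digit maps $\delta:Z_K^w(F)\to Z_k(\mathrm{in}_w(F))$ and $\delta:Z_K^w(F^{[w]})\to Z_k(\mathrm{in}_w(F))$ are well defined between these sets of roots and are bijections.
   Context: Let $v:K\to\mathbb{R}\cup\{\infty\}$ be the discrete (nontrivial) valuation, $A=\{x: v(x)\ge 0\}$ the valuation ring, $\mathfrak{M}=\{x:v(x)>0\}=\pi A$ its maximal ideal with a fixed generator $\pi$, and $k=A/\mathfrak{M}$. The first digit of $x\in K^\ast$ is $\delta(x)=\pi^{-v(x)/v(\pi)}x \bmod \mathfrak{M}\in k^\ast$; $v$ and $\delta$ are applied componentwise to vectors in $(K^\ast)^n$. For a nonzero $f=\sum_{i=1}^t a_iX^{\alpha_i}\in K[X_1^{\pm1},\ldots,X_n^{\pm1}]$ (with $a_i\in K^\ast$ and distinct $\alpha_i\in\mathbb{Z}^n$) and $w\in\mathbb{R}^n$, put $l_i(f;w)=v(a_i)+\alpha_i\cdot w$ and $\mathrm{tr}(f;w)=\min_i l_i(f;w)$. The set $\mathrm{Trop}(f)\subseteq\mathbb{R}^n$ consists of the points where $\mathrm{tr}(f;\cdot)$ is not differentiable (equivalently, where the minimum is attained by at least two indices $i$). The lower polynomial is $f^{[w]}=\sum_{i:\,l_i(f;w)=\mathrm{tr}(f;w)}a_iX^{\alpha_i}$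 and the initial form is $\mathrm{in}_w(f)=\sum_{i:\,l_i(f;w)=\mathrm{tr}(f;w)}\delta(a_i)X^{\alpha_i}\in k[X_1^{\pm1},\ldots,X_n^{\pm1}]$. For a system $F=(f_1,\ldots,f_n)$: $\mathrm{Trop}(F)=\bigcap_i\mathrm{Trop}(f_i)$, $F^{[w]}=(f_1^{[w]},\ldots,f_n^{[w]})$, $\mathrm{in}_w(F)=(\mathrm{in}_w(f_1),\ldots,\mathrm{in}_w(f_n))$. A zero of a square system is degenerate if the Jacobian determinant of the system vanishes at it. $F$ is semiregular at $w\in\mathbb{R}^n$ if either $w\notin\mathrm{Trop}(F)\cap v(\pi)\mathbb{Z}^n$ or $\mathrm{in}_w(F)$ has no degenerate zero in $(k^\ast)^n$. $Z_K(F)$ is the set of zeros of $F$ in $(K^\ast)^n$, $Z_K^w(F)$ the subset of those with valuation vector $w$, and $Z_k(G)$ the set of zeros in $(k^\ast)^n$ of a system $G$ over $k$. *)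

theory Defs
  imports "HOL-Analysis.Analysis" "HOL-Library.Poly_Mapping"
begin

section \<open>Discretely valued fields\<close>

text \<open>The value group is required to be a discrete subset of the real line and, through
  \<open>val_nontrivial\<close>, different from \<open>{0}\<close>. It is not normalised to the integers.\<close>

class discretely_valued_field = field +
  fixes val :: "'a \<Rightarrow> ereal"
  assumes val_not_MInf: "val x \<noteq> -\<infinity>"
    and val_eq_PInf_iff: "val x = \<infinity> \<longleftrightarrow> x = 0"
    and val_mult: "val (x * y) = val x + val y"
    and val_add: "min (val x) (val y) \<le> val (x + y)"
    and val_nontrivial: "\<exists>x. x \<noteq> 0 \<and> val x \<noteq> 0"
    and val_discrete: "discrete {r :: real. \<exists>x. val x = ereal r}"

definition val_ring :: "'a::discretely_valued_field set" where
  "val_ring = {x. 0 \<le> val x}"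

definition val_ideal :: "'a::discretely_valued_field set" where
  "val_ideal = {x. 0 < val x}"

definition uniformizer :: "'a::discretely_valued_field \<Rightarrow> bool" where
  "uniformizer p \<longleftrightarrow> val_ideal = {p * a | a. a \<in> val_ring}"

definition val_Cauchy :: "(nat \<Rightarrow> 'a::discretely_valued_field) \<Rightarrow> bool" where
  "val_Cauchy X \<longleftrightarrow> (\<forall>B::real. \<exists>N. \<forall>m\<ge>N. \<forall>n\<ge>N. ereal B < val (X m - X n))"

definition val_tendsto :: "(nat \<Rightarrow> 'a::discretely_valued_field) \<Rightarrow> 'a \<Rightarrow> bool" where
  "val_tendsto X L \<longleftrightarrow> (\<forall>B::real. \<exists>N. \<forall>n\<ge>N. ereal B < val (X n - L))"

definition val_complete :: "'a::discretely_valued_field itself \<Rightarrow> bool" where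
  "val_complete _ \<longleftrightarrow> (\<forall>X :: nat \<Rightarrow> 'a. val_Cauchy X \<longrightarrow> (\<exists>L. val_tendsto X L))"


section \<open>The residue field\<close>

lemma val_0 [simp]: "val (0 :: 'a::discretely_valued_field) = \<infinity>"
  by (simp add: val_eq_PInf_iff)

lemma val_1 [simp]: "val (1 :: 'a::discretely_valued_field) = 0"
proof -
  have "val (1::'a) = val (1::'a) + val (1::'a)"
    using val_mult[of "1::'a" 1] by simp
  moreover have "\<bar>val (1::'a)\<bar> \<noteq> \<infinity>"
    using val_not_MInf[of "1::'a"] val_eq_PInf_iff[of "1::'a"] by auto
  ultimately show ?thesis
    by (cases "val (1::'a)") auto
qed

lemma val_minus [simp]: "val (- x) = val (x :: 'a::discretely_valued_field)"
proof -
  have "val (-1::'a) + val (-1::'a) = 0"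
    using val_mult[of "-1::'a" "-1"] by simp
  then have "val (-1::'a) = 0"
    by (cases "val (-1::'a)") auto
  then show ?thesis
    using val_mult[of "-1" x] by simp
qed

lemma val_inverse_unit:
  fixes x :: "'a::discretely_valued_field"
  assumes "val x = 0"
  shows "val (inverse x) = 0"
proof -
  have "x \<noteq> 0"
    using assms by auto
  then show ?thesis
    using val_mult[of x "inverse x"] assms by simp
qed

lemma val_ring_0 [simp]: "0 \<in> val_ring"
  and val_ring_1 [simp]: "1 \<in> val_ring"
  and val_ring_minus: "x \<in> val_ring \<Longrightarrow> - x \<in> val_ring"
  and val_ideal_0 [simp]: "0 \<in> val_ideal"
  and one_notin_val_ideal [simp]: "1 \<notin> val_ideal"
  and val_ideal_minus: "x \<in> val_ideal \<Longrightarrow> - x \<in> val_ideal"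
  by (simp_all add: val_ring_def val_ideal_def)

lemma val_ring_add: "x \<in> val_ring \<Longrightarrow> y \<in> val_ring \<Longrightarrow> x + y \<in> val_ring"
  using val_add[of x y] by (auto simp: val_ring_def min_def split: if_splits)

lemma val_ideal_add: "x \<in> val_ideal \<Longrightarrow> y \<in> val_ideal \<Longrightarrow> x + y \<in> val_ideal"
  using val_add[of x y] by (auto simp: val_ideal_def min_def split: if_splits)

lemma val_ring_mult: "x \<in> val_ring \<Longrightarrow> y \<in> val_ring \<Longrightarrow> x * y \<in> val_ring"
  by (simp add: val_ring_def val_mult)

lemma val_ideal_mult: "x \<in> val_ring \<Longrightarrow> y \<in> val_ideal \<Longrightarrow> x * y \<in> val_ideal"
  by (simp add: val_ring_def val_ideal_def val_mult add_nonneg_pos)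

definition residue_rel :: "'a::discretely_valued_field \<Rightarrow> 'a \<Rightarrow> bool" where
  "residue_rel x y \<longleftrightarrow> x \<in> val_ring \<and> y \<in> val_ring \<and> x - y \<in> val_ideal"

lemma residue_rel_part_equivp: "part_equivp residue_rel"
proof (rule part_equivpI)
  show "\<exists>x :: 'a. residue_rel x x"
    by (rule exI[of _ 0]) (simp add: residue_rel_def)
  show "symp (residue_rel :: 'a \<Rightarrow> _)"
    using val_ideal_minus by (fastforce simp: symp_def residue_rel_def)
  show "transp (residue_rel :: 'a \<Rightarrow> _)"
  proof (rule transpI)
    fix x y z :: 'a
    assume "residue_rel x y" "residue_rel y z"
    then show "residue_rel x z"
      using val_ideal_add[of "x - y" "y - z"] by (simp add: residue_rel_def)
  qed
qed

text \<open>The type \<open>'a residue\<close> is the quotient of the valuation ring by its maximal ideal;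
  \<open>residue_class x\<close> is meaningful only for \<open>x \<in> val_ring\<close>.\<close>

quotient_type (overloaded) 'a residue = "'a::discretely_valued_field" / partial: residue_rel
  by (rule residue_rel_part_equivp)

instantiation residue :: (discretely_valued_field) field
begin

lift_definition zero_residue :: "'a residue" is 0
  by (simp add: residue_rel_def)

lift_definition one_residue :: "'a residue" is 1
  by (simp add: residue_rel_def)

lift_definition plus_residue :: "'a residue \<Rightarrow> 'a residue \<Rightarrow> 'a residue" is "(+)"
proof -
  fix a b c d :: 'a
  assume "residue_rel a b" "residue_rel c d"
  then show "residue_rel (a + c) (b + d)"
    using val_ideal_add[of "a - b" "c - d"]
    by (simp add: residue_rel_def val_ring_add algebra_simps)
qed

lift_definition uminus_residue :: "'a residue \<Rightarrow> 'a residue" is uminus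
proof -
  fix a b :: 'a
  assume "residue_rel a b"
  then show "residue_rel (- a) (- b)"
    using val_ideal_minus[of "a - b"] by (simp add: residue_rel_def val_ring_minus)
qed

lift_definition minus_residue :: "'a residue \<Rightarrow> 'a residue \<Rightarrow> 'a residue" is "(-)"
proof -
  fix a b c d :: 'a
  assume *: "residue_rel a b" "residue_rel c d"
  then have "(a - b) + - (c - d) \<in> val_ideal"
    by (intro val_ideal_add val_ideal_minus) (simp_all add: residue_rel_def)
  moreover have "a + - c \<in> val_ring" "b + - d \<in> val_ring"
    using * by (auto intro!: val_ring_add val_ring_minus simp: residue_rel_def
      simp del: add_uminus_conv_diff)
  ultimately show "residue_rel (a - c) (b - d)"
    by (simp add: residue_rel_def algebra_simps)
qed

lift_definition times_residue :: "'a residue \<Rightarrow> 'a residue \<Rightarrow> 'a residue" is "(*)"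
proof -
  fix a b c d :: 'a
  assume *: "residue_rel a b" "residue_rel c d"
  then have "c * (a - b) + b * (c - d) \<in> val_ideal"
    by (intro val_ideal_add val_ideal_mult) (simp_all add: residue_rel_def)
  then show "residue_rel (a * c) (b * d)"
    using * by (simp add: residue_rel_def val_ring_mult algebra_simps)
qed

lift_definition inverse_residue :: "'a residue \<Rightarrow> 'a residue"
  is "\<lambda>x. if x \<in> val_ideal then 0 else inverse x"
proof -
  fix a b :: 'a
  assume "residue_rel a b"
  then have R: "a \<in> val_ring" "b \<in> val_ring" "a - b \<in> val_ideal"
    by (auto simp: residue_rel_def)
  have iff: "a \<in> val_ideal \<longleftrightarrow> b \<in> val_ideal"
    using R(3) val_ideal_add[of "a - b" b] val_ideal_add[of "- (a - b)" a]
      val_ideal_minus[of "a - b"] by auto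
  show "residue_rel (if a \<in> val_ideal then 0 else inverse a)
          (if b \<in> val_ideal then 0 else inverse b)"
  proof (cases "a \<in> val_ideal")
    case True
    then show ?thesis
      using iff by (simp add: residue_rel_def)
  next
    case False
    then have v: "val a = 0" "val b = 0"
      using R iff by (auto simp: val_ring_def val_ideal_def)
    then have "a \<noteq> 0" "b \<noteq> 0"
      by auto
    then have eq: "inverse a - inverse b = (inverse a * inverse b) * - (a - b)"
      by (simp add: field_simps)
    have inv: "inverse a \<in> val_ring" "inverse b \<in> val_ring"
      using v by (simp_all add: val_ring_def val_inverse_unit)
    have "inverse a - inverse b \<in> val_ideal"
      unfolding eq by (intro val_ideal_mult val_ring_mult val_ideal_minus inv R)
    then show ?thesis
      using False iff inv by (simp add: residue_rel_def)
  qed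
qed

definition divide_residue :: "'a residue \<Rightarrow> 'a residue \<Rightarrow> 'a residue" where
  "divide_residue x y = x * inverse y"

instance
proof
  fix a b c :: "'a residue"
  show "a + b + c = a + (b + c)"
    by transfer (simp add: residue_rel_def val_ring_add algebra_simps)
  show "a + b = b + a"
    by transfer (simp add: residue_rel_def val_ring_add algebra_simps)
  show "0 + a = a"
    by transfer (simp add: residue_rel_def)
  show "- a + a = 0"
    by transfer (simp add: residue_rel_def)
  show "a - b = a + - b"
  proof transfer
    fix a b :: 'a
    assume "residue_rel a a" "residue_rel b b"
    then have "a + - b \<in> val_ring"
      by (auto simp: residue_rel_def simp del: add_uminus_conv_diff
        intro!: val_ring_add val_ring_minus)
    then show "residue_rel (a - b) (a + - b)"
      by (simp add: residue_rel_def)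
  qed
  show "a * b * c = a * (b * c)"
    by transfer (simp add: residue_rel_def val_ring_mult algebra_simps)
  show "a * b = b * a"
    by transfer (simp add: residue_rel_def val_ring_mult algebra_simps)
  show "1 * a = a"
    by transfer (simp add: residue_rel_def)
  show "(a + b) * c = a * c + b * c"
    by transfer (simp add: residue_rel_def val_ring_mult val_ring_add algebra_simps)
  show "(0 :: 'a residue) \<noteq> 1"
    by transfer (use val_ideal_minus[of "- (1::'a)"] in \<open>auto simp: residue_rel_def\<close>)
  show "a div b = a * inverse b"
    by (simp add: divide_residue_def)
  show "inverse (0 :: 'a residue) = 0"
    by transfer (simp add: residue_rel_def)
  show "inverse a * a = 1" if "a \<noteq> 0"
    using that
  proof transfer
    fix a :: 'a
    assume "residue_rel a a" "\<not> residue_rel a 0"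
    then have "a \<in> val_ring" "a \<notin> val_ideal" "a \<noteq> 0"
      by (auto simp: residue_rel_def)
    then show "residue_rel ((if a \<in> val_ideal then 0 else inverse a) * a) 1"
      by (simp add: residue_rel_def)
  qed
qed

end

definition residue_class :: "'a::discretely_valued_field \<Rightarrow> 'a residue" where
  "residue_class x = abs_residue x"

text \<open>For \<open>x \<noteq> 0\<close> and a uniformizer \<open>p\<close> the quotient of the two valuations is an integer;
  \<open>floor\<close> only converts it from type \<^typ>\<open>real\<close> to type \<^typ>\<open>int\<close>.\<close>

definition first_digit :: "'a::discretely_valued_field \<Rightarrow> 'a \<Rightarrow> 'a residue" where
  "first_digit p x =
     residue_class (p powi (- \<lfloor>real_of_ereal (val x) / real_of_ereal (val p)\<rfloor>) * x)"

definition first_digit_vec ::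
    "'a::discretely_valued_field \<Rightarrow> 'a ^ 'n \<Rightarrow> 'a residue ^ 'n" where
  "first_digit_vec p x = (\<chi> i. first_digit p (x $ i))"


section \<open>Laurent polynomials and their zeros in the torus\<close>

text \<open>A Laurent polynomial in variables indexed by \<open>'n\<close> is its finitely supported
  coefficient function on exponent vectors.\<close>

type_synonym ('n, 'a) laurent = "(int ^ 'n) \<Rightarrow>\<^sub>0 'a"

definition laurent_eval :: "('n::finite, 'a::field) laurent \<Rightarrow> 'a ^ 'n \<Rightarrow> 'a" where
  "laurent_eval f x =
     (\<Sum>\<alpha>\<in>Poly_Mapping.keys f. Poly_Mapping.lookup f \<alpha> * (\<Prod>i\<in>UNIV. (x $ i) powi (\<alpha> $ i)))"

definition laurent_pderiv :: "'n \<Rightarrow> ('n::finite, 'a::field) laurent \<Rightarrow> ('n, 'a) laurent" where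
  "laurent_pderiv j f =
     (\<Sum>\<alpha>\<in>Poly_Mapping.keys f.
        Poly_Mapping.single (\<alpha> - axis j 1) (of_int (\<alpha> $ j) * Poly_Mapping.lookup f \<alpha>))"

definition laurent_jacobian ::
    "('n::finite, 'a::field) laurent ^ 'n \<Rightarrow> 'a ^ 'n \<Rightarrow> 'a ^ 'n ^ 'n" where
  "laurent_jacobian F x = (\<chi> i j. laurent_eval (laurent_pderiv j (F $ i)) x)"

definition torus_zeros :: "('n::finite, 'a::field) laurent ^ 'n \<Rightarrow> ('a ^ 'n) set" where
  "torus_zeros F = {x. (\<forall>i. x $ i \<noteq> 0) \<and> (\<forall>i. laurent_eval (F $ i) x = 0)}"

definition torus_zeros_at ::
    "('n::finite, 'a::discretely_valued_field) laurent ^ 'n \<Rightarrow> real ^ 'n \<Rightarrow> ('a ^ 'n) set" where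
  "torus_zeros_at F w = {x \<in> torus_zeros F. \<forall>i. val (x $ i) = ereal (w $ i)}"

definition degenerate_zero ::
    "('n::finite, 'a::field) laurent ^ 'n \<Rightarrow> 'a ^ 'n \<Rightarrow> bool" where
  "degenerate_zero F x \<longleftrightarrow> x \<in> torus_zeros F \<and> det (laurent_jacobian F x) = 0"


section \<open>Tropicalization\<close>

definition trop_linear ::
    "('n::finite, 'a::discretely_valued_field) laurent \<Rightarrow> int ^ 'n \<Rightarrow> real ^ 'n \<Rightarrow> real" where
  "trop_linear f \<alpha> w =
     real_of_ereal (val (Poly_Mapping.lookup f \<alpha>)) + (\<Sum>i\<in>UNIV. of_int (\<alpha> $ i) * w $ i)"

definition trop_fun ::
    "('n::finite, 'a::discretely_valued_field) laurent \<Rightarrow> real ^ 'n \<Rightarrow> real" where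
  "trop_fun f w = Min ((\<lambda>\<alpha>. trop_linear f \<alpha> w) ` Poly_Mapping.keys f)"

definition Trop :: "('n::finite, 'a::discretely_valued_field) laurent \<Rightarrow> (real ^ 'n) set" where
  "Trop f = {w. \<not> trop_fun f differentiable (at w)}"

definition Trop_system ::
    "('n::finite, 'a::discretely_valued_field) laurent ^ 'n \<Rightarrow> (real ^ 'n) set" where
  "Trop_system F = (\<Inter>i. Trop (F $ i))"

definition min_exponents ::
    "('n::finite, 'a::discretely_valued_field) laurent \<Rightarrow> real ^ 'n \<Rightarrow> (int ^ 'n) set" where
  "min_exponents f w = {\<alpha> \<in> Poly_Mapping.keys f. trop_linear f \<alpha> w = trop_fun f w}"

definition lower_poly ::
    "real ^ 'n \<Rightarrow> ('n::finite, 'a::discretely_valued_field) laurent \<Rightarrow> ('n, 'a) laurent" where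
  "lower_poly w f =
     (\<Sum>\<alpha>\<in>min_exponents f w. Poly_Mapping.single \<alpha> (Poly_Mapping.lookup f \<alpha>))"

definition initial_form ::
    "'a \<Rightarrow> real ^ 'n \<Rightarrow> ('n::finite, 'a::discretely_valued_field) laurent
      \<Rightarrow> ('n, 'a residue) laurent" where
  "initial_form p w f =
     (\<Sum>\<alpha>\<in>min_exponents f w.
        Poly_Mapping.single \<alpha> (first_digit p (Poly_Mapping.lookup f \<alpha>)))"

definition lower_system ::
    "real ^ 'n \<Rightarrow> ('n::finite, 'a::discretely_valued_field) laurent ^ 'n
      \<Rightarrow> ('n, 'a) laurent ^ 'n" where
  "lower_system w F = (\<chi> i. lower_poly w (F $ i))"

definition initial_system ::
    "'a \<Rightarrow> real ^ 'n \<Rightarrow> ('n::finite, 'a::discretely_valued_field) laurent ^ 'n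
      \<Rightarrow> ('n, 'a residue) laurent ^ 'n" where
  "initial_system p w F = (\<chi> i. initial_form p w (F $ i))"

definition val_lattice :: "'a::discretely_valued_field \<Rightarrow> (real ^ 'n) set" where
  "val_lattice p = {w. \<exists>m :: int ^ 'n. \<forall>i. w $ i = real_of_ereal (val p) * of_int (m $ i)}"

definition semiregular_at ::
    "'a \<Rightarrow> ('n::finite, 'a::discretely_valued_field) laurent ^ 'n \<Rightarrow> real ^ 'n \<Rightarrow> bool" where
  "semiregular_at p F w \<longleftrightarrow>
     w \<notin> Trop_system F \<inter> val_lattice p \<or>
     \<not> (\<exists>\<xi>. degenerate_zero (initial_system p w F) \<xi>)"

end

theory Submission
  imports Defs
begin

text \<open>The theorem is Hensel's lemma in several variables, after a change of coordinates.

Write \<open>w = v(p) m\<close> with \<open>m\<close> an integer vector. The substitution \<open>x\<^sub>i = p ^ m\<^sub>i y\<^sub>i\<close>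
carries the points \<open>x\<close> of valuation \<open>w\<close> to the points \<open>y\<close> whose coordinates are units of the
valuation ring, and the first digit of \<open>x\<close> is the residue class of \<open>y\<close>. Since all valuations are
integer multiples of \<open>v(p)\<close>, the tropical value of each \<open>f\<^sub>i\<close> at \<open>w\<close> is \<open>v(p) c\<^sub>i\<close> for an
integer \<open>c\<^sub>i\<close>; after division by \<open>p ^ c\<^sub>i\<close> the substituted polynomial has coefficients in the
valuation ring, and precisely those at minimal exponents are units, so that its reduction modulo the
maximal ideal is the initial form of \<open>f\<^sub>i\<close>
(\<open>laurent_eval_scale_point\<close>, \<open>rescale_reduces_to_initial_form\<close>). It remains to show that
every zero of the reduced system, all of which are nondegenerate by semiregularity, lifts to exactly
one zero with unit coordinates (\<open>hensel_laurent_system\<close>).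

For the lifting, let \<open>a\<close> be any lift of the given residue zero, \<open>M\<close> the Jacobian matrix of the
system \<open>G\<close> at \<open>a\<close>, and \<open>B\<close> an entrywise lift of the inverse of the reduced Jacobian matrix. Then
\<open>B M\<close> and \<open>M B\<close> are congruent to the identity modulo the maximal ideal. The simplified Newton map
\<open>x \<mapsto> x - B G(x)\<close> is a contraction of the residue disc of \<open>a\<close>, because on that disc \<open>G(x) - G(y)\<close>
agrees with \<open>M (x - y)\<close> up to terms of higher order (\<open>expands_laurent_eval\<close>). Completeness yields
a unique fixed point (\<open>ultrametric_fixed_point\<close>), and fixed points are zeros of \<open>G\<close> since
\<open>M B\<close> close to the identity forces \<open>B\<close> to be injective.

The statement about the lower polynomials is the same statement for another system: \<open>F\<close> and its
lower system have the same initial system at \<open>w\<close> (\<open>initial_form_lower_poly\<close>).\<close>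

section \<open>Ultrametric inequalities\<close>

lemma val_add_ge: "s \<le> val x \<Longrightarrow> s \<le> val y \<Longrightarrow> s \<le> val (x + y :: 'a::discretely_valued_field)"
  using val_add[of x y] by (meson min.boundedI order_trans)

lemma val_diff_ge: "s \<le> val x \<Longrightarrow> s \<le> val y \<Longrightarrow> s \<le> val (x - y :: 'a::discretely_valued_field)"
  using val_add_ge[of s x "- y"] by simp

lemma val_diff_commute: "val (x - y) = val (y - x :: 'a::discretely_valued_field)"
  using val_minus[of "x - y"] by simp

lemma val_sum_ge:
  fixes f :: "'b \<Rightarrow> 'a::discretely_valued_field"
  shows "(\<And>i. i \<in> S \<Longrightarrow> s \<le> val (f i)) \<Longrightarrow> s \<le> val (sum f S)"
  by (induction S rule: infinite_finite_induct) (auto intro!: val_add_ge)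

lemma val_mult_ge:
  "s \<le> val x \<Longrightarrow> t \<le> val y \<Longrightarrow> s + t \<le> val (x * y :: 'a::discretely_valued_field)"
  by (simp add: val_mult add_mono)

lemma val_mult_ge_left:
  "s \<le> val x \<Longrightarrow> 0 \<le> val y \<Longrightarrow> s \<le> val (x * y :: 'a::discretely_valued_field)"
  using val_mult_ge[of s x 0 y] by simp

lemma val_mult_ge_right:
  "0 \<le> val x \<Longrightarrow> s \<le> val y \<Longrightarrow> s \<le> val (x * y :: 'a::discretely_valued_field)"
  using val_mult_ge[of 0 x s y] by simp

lemma val_finite:
  assumes "(x :: 'a::discretely_valued_field) \<noteq> 0"
  obtains r where "val x = ereal r"
  using val_not_MInf[of x] val_eq_PInf_iff[of x] assms by (cases "val x") auto

lemma val_inverse: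
  assumes "val x = ereal r"
  shows "val (inverse x :: 'a::discretely_valued_field) = ereal (- r)"
proof -
  have "x \<noteq> 0" using assms by auto
  then have "val x + val (inverse x) = 0"
    using val_mult[of x "inverse x"] by simp
  then show ?thesis
    using assms by (cases "val (inverse x)") (auto simp: zero_ereal_def)
qed

lemma val_power:
  assumes "val x = ereal r"
  shows "val (x ^ n :: 'a::discretely_valued_field) = ereal (of_nat n * r)"
  by (induction n) (auto simp: assms val_mult algebra_simps)

lemma val_powi:
  assumes "val x = ereal r"
  shows "val (x powi k :: 'a::discretely_valued_field) = ereal (of_int k * r)"
  by (cases k rule: int_cases3)
    (auto simp: power_int_minus val_inverse[OF val_power[OF assms]] val_power[OF assms])

lemma val_unit_powi: "val x = 0 \<Longrightarrow> val (x powi k :: 'a::discretely_valued_field) = 0"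
  using val_powi[of x 0 k] by (simp add: zero_ereal_def)

lemma val_unit_prod_powi:
  fixes x :: "'a::discretely_valued_field ^ 'n"
  assumes "\<And>i. val (x $ i) = 0"
  shows "val (\<Prod>i\<in>S. (x $ i) powi (m i)) = 0"
  by (induction S rule: infinite_finite_induct) (auto simp: val_mult val_unit_powi[OF assms])

lemma val_of_nat_ge: "0 \<le> val (of_nat n :: 'a::discretely_valued_field)"
  by (induction n) (auto intro!: val_add_ge)

lemma val_of_int_ge: "0 \<le> val (of_int k :: 'a::discretely_valued_field)"
  by (cases k rule: int_cases2) (auto simp: val_of_nat_ge)

lemma eq_if_val_unbounded:
  assumes "\<And>B::real. ereal B \<le> val (x - y :: 'a::discretely_valued_field)"
  shows "x = y"
  using assms by (metis eq_iff_diff_eq_0 ereal_top val_eq_PInf_iff)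

section \<open>Uniformizers and the value group\<close>

text \<open>A generator of the maximal ideal has the smallest positive valuation; this value \<open>\<rho>\<close> is the
contraction constant of the lifting argument. That the ideal is nonzero follows from the
nontriviality of the valuation, after passing to an inverse if necessary.\<close>

lemma uniformizer_val:
  assumes "uniformizer (p :: 'a::discretely_valued_field)"
  obtains \<rho> where "val p = ereal \<rho>" "0 < \<rho>" "\<And>x :: 'a. 0 < val x \<Longrightarrow> ereal \<rho> \<le> val x"
proof -
  obtain x :: 'a where x: "x \<noteq> 0" "val x \<noteq> 0" using val_nontrivial by blast
  obtain r where r: "val x = ereal r" by (rule val_finite[OF x(1)])
  have "\<exists>y :: 'a. y \<noteq> 0 \<and> 0 < val y"
  proof (cases "0 < r")
    case True
    then show ?thesis using r x by auto
  next
    case False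
    then have "0 < val (inverse x)" using x r val_inverse[OF r] by (auto simp: zero_ereal_def)
    then show ?thesis using x by (intro exI[of _ "inverse x"]) auto
  qed
  then obtain y :: 'a where y: "y \<noteq> 0" "0 < val y" by blast
  have ideal: "val_ideal = {p * a | a. a \<in> val_ring}"
    using assms by (simp add: uniformizer_def)
  have "p \<noteq> 0" using y ideal by (auto simp: val_ideal_def)
  then obtain \<rho> where \<rho>: "val p = ereal \<rho>" by (rule val_finite)
  have "p \<in> val_ideal" unfolding ideal using val_ring_1 by force
  then have "0 < \<rho>" using \<rho> by (simp add: val_ideal_def)
  moreover have "ereal \<rho> \<le> val x" if "0 < val x" for x :: 'a
  proof -
    have "x \<in> {p * a | a. a \<in> val_ring}" unfolding ideal[symmetric] using that by (simp add: val_ideal_def)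
    then obtain a where "x = p * a" "0 \<le> val a" by (auto simp: val_ring_def)
    then show ?thesis using val_mult_ge_left[of "ereal \<rho>" p a] \<rho> by simp
  qed
  ultimately show ?thesis using that \<rho> by blast
qed

text \<open>Division with remainder of a value by \<open>\<rho>\<close>: the remainder is again a value, smaller than the
smallest positive one, hence zero.\<close>

lemma uniformizer_val_integral:
  fixes p :: "'a::discretely_valued_field"
  assumes \<rho>: "val p = ereal \<rho>" "0 < \<rho>" "\<And>x :: 'a. 0 < val x \<Longrightarrow> ereal \<rho> \<le> val x"
    and "(x :: 'a) \<noteq> 0"
  shows "\<exists>k::int. val x = ereal (\<rho> * of_int k)"
proof -
  obtain r where r: "val x = ereal r" by (rule val_finite[OF \<open>x \<noteq> 0\<close>])
  define k where "k = \<lfloor>r / \<rho>\<rfloor>"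
  have v: "val (x * p powi (- k)) = ereal (r - \<rho> * of_int k)"
    by (simp add: val_mult r val_powi[OF \<rho>(1)])
  have k: "of_int k \<le> r / \<rho>" "r / \<rho> < of_int k + 1"
    unfolding k_def by linarith+
  have "0 \<le> r - \<rho> * of_int k" "r - \<rho> * of_int k < \<rho>"
    using k \<rho>(2) by (simp_all add: field_simps)
  moreover have "\<not> 0 < r - \<rho> * of_int k"
    using \<rho>(3)[of "x * p powi (- k)"] v calculation(2) by auto
  ultimately show ?thesis using r by (intro exI[of _ k]) auto
qed


section \<open>Reduction to the residue field\<close>

lemma residue_rel_refl_iff: "residue_rel x x \<longleftrightarrow> 0 \<le> val x"
  by (simp add: residue_rel_def val_ring_def)

lemma residue_class_0 [simp]: "residue_class (0 :: 'a::discretely_valued_field) = 0"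
  and residue_class_1 [simp]: "residue_class (1 :: 'a::discretely_valued_field) = 1"
  by (simp_all add: residue_class_def zero_residue.abs_eq one_residue.abs_eq)

lemma residue_class_eq_iff:
  assumes "0 \<le> val x" "0 \<le> val y"
  shows "residue_class x = residue_class y \<longleftrightarrow> 0 < val (x - y)"
  using Quotient3_rel[OF Quotient3_residue, of x y] assms
  by (auto simp: residue_class_def residue_rel_refl_iff residue_rel_def val_ring_def val_ideal_def)

lemma residue_class_eq_0_iff: "0 \<le> val x \<Longrightarrow> residue_class x = 0 \<longleftrightarrow> 0 < val x"
  using residue_class_eq_iff[of x 0] by simp

lemma residue_class_ne_0_iff: "0 \<le> val x \<Longrightarrow> residue_class x \<noteq> 0 \<longleftrightarrow> val x = 0"
  by (auto simp: residue_class_eq_0_iff)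

lemma residue_class_add:
  "0 \<le> val x \<Longrightarrow> 0 \<le> val y \<Longrightarrow> residue_class (x + y) = residue_class x + residue_class y"
  by (simp add: residue_class_def plus_residue.abs_eq residue_rel_refl_iff)

lemma residue_class_mult:
  "0 \<le> val x \<Longrightarrow> 0 \<le> val y \<Longrightarrow> residue_class (x * y) = residue_class x * residue_class y"
  by (simp add: residue_class_def times_residue.abs_eq residue_rel_refl_iff)

lemma residue_class_minus: "0 \<le> val x \<Longrightarrow> residue_class (- x) = - residue_class x"
  by (simp add: residue_class_def uminus_residue.abs_eq residue_rel_refl_iff)

lemma residue_class_inverse: "val x = 0 \<Longrightarrow> residue_class (inverse x) = inverse (residue_class x)"
  by (simp add: residue_class_def inverse_residue.abs_eq residue_rel_refl_iff val_ideal_def)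

lemma residue_class_surj:
  obtains x :: "'a::discretely_valued_field" where "0 \<le> val x" "residue_class x = z"
  by (induction z rule: residue.abs_induct) (auto simp: residue_class_def residue_rel_refl_iff)

lemma residue_class_sum:
  assumes "\<And>i. i \<in> S \<Longrightarrow> 0 \<le> val (f i)"
  shows "residue_class (sum f S) = (\<Sum>i\<in>S. residue_class (f i))"
  using assms
  by (induction S rule: infinite_finite_induct) (auto simp: residue_class_add val_sum_ge)

lemma residue_class_power: "0 \<le> val x \<Longrightarrow> residue_class (x ^ n) = residue_class x ^ n"
proof (induction n)
  case (Suc n)
  have "0 \<le> val (x ^ n)"
    using Suc.prems by (induction n) (auto intro!: val_mult_ge_left)
  then show ?case using Suc by (simp add: residue_class_mult)
qed simp

lemma residue_class_powi: "val x = 0 \<Longrightarrow> residue_class (x powi k) = residue_class x powi k"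
  using val_unit_powi[of x "int n" for n]
  by (cases k rule: int_cases3)
    (auto simp: power_int_minus residue_class_power residue_class_inverse)

lemma residue_class_prod_powi:
  fixes x :: "'a::discretely_valued_field ^ 'n"
  assumes "\<And>i. val (x $ i) = 0"
  shows "residue_class (\<Prod>i\<in>S. (x $ i) powi (m i)) = (\<Prod>i\<in>S. residue_class (x $ i) powi (m i))"
  by (induction S rule: infinite_finite_induct)
    (auto simp: residue_class_mult residue_class_powi assms val_unit_powi val_unit_prod_powi)

lemma residue_class_of_nat: "residue_class (of_nat n :: 'a::discretely_valued_field) = of_nat n"
  by (induction n) (auto simp: residue_class_add val_of_nat_ge)

lemma residue_class_of_int: "residue_class (of_int k :: 'a::discretely_valued_field) = of_int k"
  by (cases k rule: int_cases2) (auto simp: residue_class_of_nat residue_class_minus val_of_nat_ge)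


section \<open>Evaluation of Laurent polynomials and their derivatives\<close>

lemma laurent_eval_superset:
  assumes "finite S" "Poly_Mapping.keys f \<subseteq> S"
  shows "laurent_eval f x =
    (\<Sum>\<alpha>\<in>S. Poly_Mapping.lookup f \<alpha> * (\<Prod>i\<in>UNIV. (x $ i) powi (\<alpha> $ i)))"
  unfolding laurent_eval_def
  by (rule sum.mono_neutral_left) (use assms in \<open>auto simp: in_keys_iff\<close>)

lemma laurent_eval_0 [simp]: "laurent_eval 0 x = 0"
  by (simp add: laurent_eval_def)

lemma laurent_eval_add: "laurent_eval (f + g) x = laurent_eval f x + laurent_eval g x"
proof -
  let ?S = "Poly_Mapping.keys f \<union> Poly_Mapping.keys g"
  have "Poly_Mapping.keys (f + g) \<subseteq> ?S" by (rule Poly_Mapping.keys_add)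
  then show ?thesis
    by (simp add: laurent_eval_superset[of ?S] lookup_add distrib_right sum.distrib)
qed

lemma laurent_eval_sum: "laurent_eval (sum f S) x = (\<Sum>i\<in>S. laurent_eval (f i) x)"
  by (induction S rule: infinite_finite_induct) (auto simp: laurent_eval_add)

lemma laurent_eval_single:
  "laurent_eval (Poly_Mapping.single \<alpha> c) x = c * (\<Prod>i\<in>UNIV. (x $ i) powi (\<alpha> $ i))"
  by (subst laurent_eval_superset[of "{\<alpha>}"]) auto

lemma laurent_eval_pderiv_superset:
  assumes "finite S" "Poly_Mapping.keys f \<subseteq> S"
  shows "laurent_eval (laurent_pderiv j f) x =
    (\<Sum>\<alpha>\<in>S. of_int (\<alpha> $ j) * Poly_Mapping.lookup f \<alpha> *
       (\<Prod>i\<in>UNIV. (x $ i) powi ((\<alpha> - axis j 1) $ i)))"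
  unfolding laurent_pderiv_def laurent_eval_sum laurent_eval_single
  by (rule sum.mono_neutral_left) (use assms in \<open>auto simp: in_keys_iff\<close>)

text \<open>Reduction modulo the maximal ideal is applied to coefficients and to coordinates; evaluation
and partial derivatives commute with it at points with unit coordinates, where the monomials
with negative exponents are integral too.\<close>

abbreviation integral_laurent :: "('n::finite, 'a::discretely_valued_field) laurent \<Rightarrow> bool" where
  "integral_laurent f \<equiv> \<forall>\<alpha>. 0 \<le> val (Poly_Mapping.lookup f \<alpha>)"

abbreviation reduce_laurent ::
    "('n::finite, 'a::discretely_valued_field) laurent \<Rightarrow> ('n, 'a residue) laurent" where
  "reduce_laurent \<equiv> Poly_Mapping.map residue_class"

abbreviation reduce_vec :: "'a::discretely_valued_field ^ 'n \<Rightarrow> 'a residue ^ 'n" where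
  "reduce_vec x \<equiv> (\<chi> i. residue_class (x $ i))"

lemma lookup_reduce_laurent:
  "Poly_Mapping.lookup (reduce_laurent f) \<alpha> = residue_class (Poly_Mapping.lookup f \<alpha>)"
  by (simp add: Poly_Mapping.map.rep_eq when_def)

lemma keys_reduce_laurent_subset: "Poly_Mapping.keys (reduce_laurent f) \<subseteq> Poly_Mapping.keys f"
  by (auto simp: in_keys_iff lookup_reduce_laurent)

lemma residue_class_laurent_eval:
  assumes "integral_laurent f" "\<And>i. val (x $ i) = 0"
  shows "residue_class (laurent_eval f x) = laurent_eval (reduce_laurent f) (reduce_vec x)"
  by (subst laurent_eval_superset[OF _ keys_reduce_laurent_subset])
    (simp_all add: laurent_eval_def residue_class_sum residue_class_mult lookup_reduce_laurent
      residue_class_prod_powi val_unit_prod_powi val_mult_ge_left assms)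

lemma val_pderiv_term_ge:
  assumes "integral_laurent f" "\<And>i. val (x $ i) = 0"
  shows "0 \<le> val (of_int k * Poly_Mapping.lookup f \<alpha> * (\<Prod>i\<in>S. (x $ i) powi (m i)))"
  by (intro val_mult_ge_left) (auto simp: val_of_int_ge assms val_unit_prod_powi)

lemma val_laurent_eval_pderiv_ge:
  assumes "integral_laurent f" "\<And>i. val (x $ i) = 0"
  shows "0 \<le> val (laurent_eval (laurent_pderiv j f) x)"
  by (subst laurent_eval_pderiv_superset[OF finite_keys order_refl])
    (intro val_sum_ge val_pderiv_term_ge assms)

lemma residue_class_laurent_eval_pderiv:
  assumes "integral_laurent f" "\<And>i. val (x $ i) = 0"
  shows "residue_class (laurent_eval (laurent_pderiv j f) x) =
    laurent_eval (laurent_pderiv j (reduce_laurent f)) (reduce_vec x)"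
proof -
  have "0 \<le> val (of_int k * Poly_Mapping.lookup f \<alpha>)" for k \<alpha>
    by (intro val_mult_ge_left) (auto simp: val_of_int_ge assms)
  then show ?thesis
    by (subst laurent_eval_pderiv_superset[OF finite_keys keys_reduce_laurent_subset],
        subst laurent_eval_pderiv_superset[OF finite_keys order_refl])
      (simp add: residue_class_sum residue_class_mult lookup_reduce_laurent
        residue_class_prod_powi val_unit_prod_powi val_of_int_ge residue_class_of_int
        val_pderiv_term_ge assms)
qed


section \<open>First-order expansion with error term\<close>

text \<open>Here \<open>expands \<rho> r c x y l\<close> records that \<open>x\<close> and \<open>y\<close> are values of a function at two points near a
base point where its value is \<open>c\<close>, and that the first-order term \<open>l\<close>, formed with the derivative at
the base point and of valuation at least \<open>r\<close>, approximates the difference \<open>x - y\<close> with an error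
of valuation at least \<open>r + \<rho>\<close>.
Coordinates have this property (\<open>expands_id\<close>), and the rules of differentiation for \<open>c\<close> and \<open>l\<close>
(as for dual numbers \<open>c + l \<epsilon>\<close>) preserve it. This gives the Taylor estimate for Laurent
polynomials without expanding them around the base point.\<close>

definition expands ::
    "ereal \<Rightarrow> ereal \<Rightarrow> 'a::discretely_valued_field \<Rightarrow> 'a \<Rightarrow> 'a \<Rightarrow> 'a \<Rightarrow> bool" where
  "expands \<rho> r c x y l \<longleftrightarrow> 0 \<le> val c \<and> \<rho> \<le> val (x - c) \<and> \<rho> \<le> val (y - c) \<and>
     r \<le> val l \<and> r + \<rho> \<le> val (x - y - l)"

lemma expands_const: "0 \<le> val b \<Longrightarrow> expands \<rho> r b b b 0"
  by (simp add: expands_def)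

lemma expands_id:
  "0 \<le> val c \<Longrightarrow> \<rho> \<le> val (x - c) \<Longrightarrow> \<rho> \<le> val (y - c) \<Longrightarrow> r \<le> val (x - y) \<Longrightarrow>
    expands \<rho> r c x y (x - y)"
  by (simp add: expands_def)

lemma expands_add:
  assumes "expands \<rho> r c x y l" "expands \<rho> r c' x' y' l'"
  shows "expands \<rho> r (c + c') (x + x') (y + y') (l + l')"
proof -
  have "x + x' - (c + c') = (x - c) + (x' - c')" "y + y' - (c + c') = (y - c) + (y' - c')"
    "x + x' - (y + y') - (l + l') = (x - y - l) + (x' - y' - l')"
    by (simp_all add: algebra_simps)
  then show ?thesis
    using assms unfolding expands_def by (metis val_add_ge)
qed

lemma expands_sum:
  assumes "\<And>i. i \<in> S \<Longrightarrow> expands \<rho> r (c i) (x i) (y i) (l i)"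
  shows "expands \<rho> r (\<Sum>i\<in>S. c i) (\<Sum>i\<in>S. x i) (\<Sum>i\<in>S. y i) (\<Sum>i\<in>S. l i)"
  using assms
  by (induction S rule: infinite_finite_induct) (auto intro!: expands_add expands_const)

lemma expands_integral:
  assumes "expands \<rho> r c x y l" "0 \<le> \<rho>"
  shows "0 \<le> val x" "0 \<le> val y"
proof -
  have "0 \<le> val (x - c)" "0 \<le> val (y - c)" "0 \<le> val c"
    using assms by (auto simp: expands_def intro: order_trans)
  then show "0 \<le> val x" "0 \<le> val y"
    using val_add_ge[of 0 "x - c" c] val_add_ge[of 0 "y - c" c] by auto
qed

text \<open>Product rule. The error is a sum of four terms, each containing either an error of a factor, or a
first-order term (of order \<open>r\<close>) times a distance to the base value (of order \<open>\<rho>\<close>).\<close>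

lemma expands_mult:
  assumes e: "expands \<rho> r c x y l" "expands \<rho> r c' x' y' l'" and "0 \<le> \<rho>"
  shows "expands \<rho> r (c * c') (x * x') (y * y') (c * l' + l * c')"
proof -
  note int = expands_integral[OF e(1) assms(3)] expands_integral[OF e(2) assms(3)]
  note e' = e[unfolded expands_def]
  have "x * x' - c * c' = (x - c) * x' + c * (x' - c')" "y * y' - c * c' = (y - c) * y' + c * (y' - c')"
    by (simp_all add: algebra_simps)
  moreover have "\<rho> \<le> val ((x - c) * x' + c * (x' - c'))" "\<rho> \<le> val ((y - c) * y' + c * (y' - c'))"
    using e' int by (auto intro!: val_add_ge intro: val_mult_ge_left val_mult_ge_right)
  moreover have "r \<le> val (c * l' + l * c')"
    using e' by (auto intro!: val_add_ge intro: val_mult_ge_left val_mult_ge_right)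
  moreover have "x * x' - y * y' - (c * l' + l * c') =
      (x - y - l) * x' + l * (x' - c') + (y * (x' - y' - l') + (y - c) * l')"
    by (simp add: algebra_simps)
  moreover have "r + \<rho> \<le> val ((x - y - l) * x' + l * (x' - c') + (y * (x' - y' - l') + (y - c) * l'))"
  proof (intro val_add_ge)
    show "r + \<rho> \<le> val ((x - y - l) * x')" "r + \<rho> \<le> val (y * (x' - y' - l'))"
      using e' int by (auto intro: val_mult_ge_left val_mult_ge_right)
    show "r + \<rho> \<le> val (l * (x' - c'))"
      using e' by (auto intro: val_mult_ge)
    show "r + \<rho> \<le> val ((y - c) * l')"
      using e' val_mult_ge[of \<rho> "y - c" r l'] by (auto simp: add.commute)
  qed
  moreover have "0 \<le> val (c * c')" using e' by (auto intro: val_mult_ge_left)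
  ultimately show ?thesis by (simp add: expands_def)
qed

text \<open>Two elements congruent modulo the maximal ideal are units together, so a whole residue disc
around a point with unit coordinates lies in the domain of the Laurent monomials.\<close>

lemma val_add_eq_0_if_small:
  assumes "val c = 0" "0 < val (x - c)"
  shows "val (x :: 'a::discretely_valued_field) = 0"
proof (rule antisym)
  show "0 \<le> val x" using val_add_ge[of 0 "x - c" c] assms by auto
  show "val x \<le> 0"
  proof (rule ccontr)
    assume "\<not> val x \<le> 0"
    then have "(c - x) + x \<in> val_ideal"
      using assms by (intro val_ideal_add) (auto simp: val_ideal_def val_diff_commute[of c])
    then show False using assms by (simp add: val_ideal_def)
  qed
qed

lemma expands_inverse:
  assumes e: "expands \<rho> r c x y l" and "0 < \<rho>" "val c = 0"
  shows "expands \<rho> r (inverse c) (inverse x) (inverse y) (- l * inverse c ^ 2)"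
proof -
  note e' = e[unfolded expands_def]
  have v: "val x = 0" "val y = 0"
    using e' assms by (auto intro!: val_add_eq_0_if_small[OF assms(3)] elim: less_le_trans)
  then have nz: "x \<noteq> 0" "y \<noteq> 0" "c \<noteq> 0" using assms by auto
  have vi: "val (inverse x) = 0" "val (inverse y) = 0" "val (inverse c) = 0"
    using v assms by (auto intro: val_inverse_unit)
  have "inverse x - inverse c = - (x - c) * (inverse x * inverse c)"
    "inverse y - inverse c = - (y - c) * (inverse y * inverse c)"
    using nz by (simp_all add: field_simps)
  then have "\<rho> \<le> val (inverse x - inverse c)" "\<rho> \<le> val (inverse y - inverse c)"
    using e' vi by (auto simp: val_mult simp del: minus_diff_eq minus_mult_left)
  moreover have "r \<le> val (- l * inverse c ^ 2)"
    using e' vi by (simp add: val_mult power2_eq_square)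
  moreover have "r + \<rho> \<le> val (inverse x - inverse y - - l * inverse c ^ 2)"
  proof -
    have "inverse x - inverse y - - l * inverse c ^ 2 =
        - (x - y - l) * (inverse x * inverse y) +
        l * ((x - c) * (inverse c * inverse c * inverse x) + (y - c) * (inverse c * inverse x * inverse y))"
      using nz by (simp add: field_simps power2_eq_square)
    moreover have "r + \<rho> \<le> val (- (x - y - l) * (inverse x * inverse y))"
      using e' vi by (intro val_mult_ge_left) (auto simp: val_mult simp del: minus_diff_eq)
    moreover have "r + \<rho> \<le> val (l * ((x - c) * (inverse c * inverse c * inverse x)
        + (y - c) * (inverse c * inverse x * inverse y)))"
      using e' vi by (intro val_mult_ge val_add_ge val_mult_ge_left) (auto simp: val_mult)
    ultimately show ?thesis by (metis val_add_ge)
  qed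
  ultimately show ?thesis using vi by (simp add: expands_def)
qed

lemma expands_power:
  assumes "expands \<rho> r c x y l" "0 \<le> \<rho>"
  shows "expands \<rho> r (c ^ n) (x ^ n) (y ^ n) (of_nat n * c ^ (n - 1) * l)"
proof (induction n)
  case 0
  then show ?case using expands_const[of 1] by simp
next
  case (Suc n)
  have "c * (of_nat n * c ^ (n - 1) * l) + l * c ^ n = of_nat (Suc n) * c ^ n * l"
    by (cases n) (simp_all add: algebra_simps)
  then show ?case using expands_mult[OF assms(1) Suc assms(2)] by simp
qed

lemma expands_powi:
  assumes e: "expands \<rho> r c x y l" and "0 < \<rho>" "val c = 0"
  shows "expands \<rho> r (c powi k :: 'a::discretely_valued_field) (x powi k) (y powi k) (of_int k * c powi (k - 1) * l)"
proof (cases k rule: int_cases4)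
  case (nonneg n)
  have "of_int k * c powi (k - 1) * l = of_nat n * c ^ (n - 1) * l"
    using nonneg by (cases n) auto
  moreover have "z powi k = z ^ n" for z :: 'a using nonneg by simp
  ultimately show ?thesis using expands_power[OF e, of n] assms(2) by (simp only: less_imp_le)
next
  case (neg n)
  have "c \<noteq> 0" using assms by auto
  then have A: "c powi (k - 1) = inverse (c ^ n) * inverse c"
    using neg by (simp add: power_int_diff power_int_minus divide_inverse)
  have B: "c ^ (n - 1) = c ^ n * inverse c"
    using \<open>c \<noteq> 0\<close> neg by (cases n) auto
  have C: "of_int k = - (of_nat n :: 'a)" using neg by simp
  have "of_int k * c powi (k - 1) * l = - (of_nat n * c ^ (n - 1) * l) * inverse (c ^ n) ^ 2"
    unfolding A B C using \<open>c \<noteq> 0\<close> by (simp add: field_simps power2_eq_square)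
  moreover have "val (c ^ n) = 0"
    using val_unit_powi[OF assms(3), of "int n"] by simp
  moreover have "z powi k = inverse (z ^ n)" for z :: 'a using neg by (simp add: power_int_minus)
  ultimately show ?thesis
    using expands_inverse[OF expands_power[OF e, of n]] assms(2) by (simp only: less_imp_le)
qed

lemma expands_prod:
  assumes "finite S" "\<And>i. i \<in> S \<Longrightarrow> expands \<rho> r (c i) (x i) (y i) (l i)" "0 \<le> \<rho>"
  shows "expands \<rho> r (\<Prod>i\<in>S. c i) (\<Prod>i\<in>S. x i) (\<Prod>i\<in>S. y i)
    (\<Sum>j\<in>S. l j * (\<Prod>i\<in>S - {j}. c i))"
  using assms(1,2)
proof (induction S rule: finite_induct)
  case empty
  then show ?case using expands_const[of 1] by simp
next
  case (insert a S)
  have "c a * (\<Sum>j\<in>S. l j * (\<Prod>i\<in>S - {j}. c i)) = (\<Sum>j\<in>S. l j * (\<Prod>i\<in>insert a S - {j}. c i))"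
    unfolding sum_distrib_left
  proof (rule sum.cong[OF refl])
    fix j assume "j \<in> S"
    then have "insert a S - {j} = insert a (S - {j})" using insert by auto
    then show "c a * (l j * (\<Prod>i\<in>S - {j}. c i)) = l j * (\<Prod>i\<in>insert a S - {j}. c i)"
      using insert by simp
  qed
  then have "c a * (\<Sum>j\<in>S. l j * (\<Prod>i\<in>S - {j}. c i)) + l a * (\<Prod>i\<in>S. c i) =
      (\<Sum>j\<in>insert a S. l j * (\<Prod>i\<in>insert a S - {j}. c i))"
    using insert by (simp add: add.commute)
  moreover have "expands \<rho> r (c a * (\<Prod>i\<in>S. c i)) (x a * (\<Prod>i\<in>S. x i)) (y a * (\<Prod>i\<in>S. y i))
    (c a * (\<Sum>j\<in>S. l j * (\<Prod>i\<in>S - {j}. c i)) + l a * (\<Prod>i\<in>S. c i))"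
    using insert by (intro expands_mult assms(3)) auto
  ultimately show ?case by (simp only: prod.insert[OF insert.hyps])
qed

text \<open>The coefficients of the first-order term of a monomial, found by the product and power rules,
are collected over the exponents into the formal partial derivatives.\<close>

lemma expands_laurent_eval:
  fixes f :: "('n::finite, 'a::discretely_valued_field) laurent"
  assumes f: "integral_laurent f" and c: "\<And>i. val (c $ i) = 0" and \<rho>: "0 < \<rho>"
    and x: "\<And>i. \<rho> \<le> val (x $ i - c $ i)" and y: "\<And>i. \<rho> \<le> val (y $ i - c $ i)"
    and r: "\<And>i. r \<le> val (x $ i - y $ i)"
  shows "expands \<rho> r (laurent_eval f c) (laurent_eval f x) (laurent_eval f y)
    (\<Sum>j\<in>UNIV. laurent_eval (laurent_pderiv j f) c * (x $ j - y $ j))"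
proof -
  let ?l = "\<lambda>\<alpha> j. of_int (\<alpha> $ j) * c $ j powi (\<alpha> $ j - 1) * (x $ j - y $ j)"
  let ?L = "\<lambda>\<alpha>. \<Sum>j\<in>UNIV. ?l \<alpha> j * (\<Prod>i\<in>UNIV - {j}. (c $ i) powi (\<alpha> $ i))"
  have "expands \<rho> r (\<Prod>i\<in>UNIV. (c $ i) powi (\<alpha> $ i)) (\<Prod>i\<in>UNIV. (x $ i) powi (\<alpha> $ i))
      (\<Prod>i\<in>UNIV. (y $ i) powi (\<alpha> $ i)) (?L \<alpha>)" for \<alpha> :: "int ^ 'n"
    using \<rho> c x y r by (intro expands_prod expands_powi expands_id) auto
  then have e: "expands \<rho> r (laurent_eval f c) (laurent_eval f x) (laurent_eval f y)
     (\<Sum>\<alpha>\<in>Poly_Mapping.keys f. Poly_Mapping.lookup f \<alpha> * ?L \<alpha> + 0 * (\<Prod>i\<in>UNIV. (c $ i) powi (\<alpha> $ i)))"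
    unfolding laurent_eval_def
    using \<rho> f by (intro expands_sum expands_mult expands_const) auto
  have D: "laurent_eval (laurent_pderiv j f) c = (\<Sum>\<alpha>\<in>Poly_Mapping.keys f. Poly_Mapping.lookup f \<alpha> *
      (of_int (\<alpha> $ j) * c $ j powi (\<alpha> $ j - 1) * (\<Prod>i\<in>UNIV - {j}. (c $ i) powi (\<alpha> $ i))))" for j
  proof -
    have "(\<Prod>i\<in>UNIV. (c $ i) powi ((\<alpha> - axis j 1) $ i)) =
      c $ j powi (\<alpha> $ j - 1) * (\<Prod>i\<in>UNIV - {j}. (c $ i) powi (\<alpha> $ i))" for \<alpha> :: "int ^ 'n"
      by (subst prod.remove[of UNIV j]) (auto simp: axis_def intro!: prod.cong)
    then show ?thesis
      by (simp add: laurent_eval_pderiv_superset[OF finite_keys order_refl] mult_ac)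
  qed
  have "(\<Sum>\<alpha>\<in>Poly_Mapping.keys f. Poly_Mapping.lookup f \<alpha> * ?L \<alpha>) =
      (\<Sum>j\<in>UNIV. laurent_eval (laurent_pderiv j f) c * (x $ j - y $ j))"
    unfolding D sum_distrib_left sum_distrib_right
    by (subst sum.swap) (intro sum.cong refl, simp add: mult_ac)
  then show ?thesis using e by simp
qed


section \<open>Fixed points of ultrametric contractions\<close>

text \<open>Banach's fixed point theorem on a residue disc. Successive iterates differ by terms of valuation
at least \<open>n \<rho>\<close>, and in an ultrametric space this bounds the distance of all later iterates, so
no geometric series is needed.\<close>

lemma ultrametric_fixed_point:
  fixes \<phi> :: "'a::discretely_valued_field ^ 'n \<Rightarrow> 'a ^ 'n" and a :: "'a ^ 'n" and \<rho> :: real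
  defines "S \<equiv> {x. \<forall>j. ereal \<rho> \<le> val (x $ j - a $ j)}"
  assumes complete: "val_complete TYPE('a)" and \<rho>: "0 < \<rho>"
    and maps: "\<And>x. x \<in> S \<Longrightarrow> \<phi> x \<in> S"
    and contraction: "\<And>x y r j. x \<in> S \<Longrightarrow> y \<in> S \<Longrightarrow> (\<And>i. ereal r \<le> val (x $ i - y $ i)) \<Longrightarrow>
      ereal (r + \<rho>) \<le> val (\<phi> x $ j - \<phi> y $ j)"
  shows "\<exists>!x. x \<in> S \<and> \<phi> x = x"
proof -
  have large: "\<exists>n. B < real n * \<rho>" for B
    using reals_Archimedean3[OF \<rho>] by blast
  have eqI: "x = y" if "\<And>n j. ereal (real n * \<rho>) \<le> val (x $ j - y $ j)" for x y :: "'a ^ 'n"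
  proof (rule vec_eq_iff[THEN iffD2], rule allI, rule eq_if_val_unbounded)
    fix j and B :: real
    obtain n where "B < real n * \<rho>" using large by blast
    then show "ereal B \<le> val (x $ j - y $ j)"
      using that[of n j] by (meson ereal_less_eq(3) less_imp_le order_trans)
  qed
  have in_S: "ereal 0 \<le> val (x $ j - y $ j)" if "x \<in> S" "y \<in> S" for x y j
  proof -
    have "ereal \<rho> \<le> val ((x $ j - a $ j) - (y $ j - a $ j))"
      using that by (intro val_diff_ge[of _ "_ - _" "_ - _"]) (auto simp: S_def)
    moreover have "ereal 0 \<le> ereal \<rho>" using \<rho> by simp
    ultimately show ?thesis by (simp del: ereal_less_eq)
  qed
  define X where "X n = (\<phi> ^^ n) a" for n
  have X_S: "X n \<in> S" for n
    by (induction n) (auto simp: X_def maps, simp add: S_def)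
  have step: "ereal (real n * \<rho>) \<le> val (X (Suc n) $ j - X n $ j)" for n j
  proof (induction n arbitrary: j)
    case 0
    then show ?case using in_S[OF X_S X_S] by simp
  next
    case (Suc n)
    then show ?case
      using contraction[OF X_S X_S Suc, of j] by (simp add: X_def algebra_simps)
  qed
  have far: "ereal (real n * \<rho>) \<le> val (X m $ j - X n $ j)" if "n \<le> m" for n m j
    using that
  proof (induction m rule: dec_induct)
    case (step m)
    have "ereal (real n * \<rho>) \<le> ereal (real m * \<rho>)" using step \<rho> by simp
    then have "ereal (real n * \<rho>) \<le> val (X (Suc m) $ j - X m $ j)"
      using \<open>\<And>n j. ereal (real n * \<rho>) \<le> val (X (Suc n) $ j - X n $ j)\<close> order_trans by blast
    then show ?case using val_add_ge[OF _ step.IH] by fastforce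
  qed simp
  have "val_Cauchy (\<lambda>n. X n $ j)" for j
    unfolding val_Cauchy_def
  proof
    fix B :: real
    obtain N where N: "B < real N * \<rho>" using large by blast
    have "ereal B < val (X m $ j - X n $ j)" if "N \<le> m" "N \<le> n" for m n
    proof -
      have "ereal (real N * \<rho>) \<le> val ((X m $ j - X N $ j) - (X n $ j - X N $ j))"
        using that by (intro val_diff_ge[of _ "_ - _" "_ - _"] far)
      then show ?thesis using N by (simp add: less_le_trans[of "ereal B" "ereal (real N * \<rho>)"])
    qed
    then show "\<exists>N. \<forall>m\<ge>N. \<forall>n\<ge>N. ereal B < val (X m $ j - X n $ j)" by blast
  qed
  then have "\<forall>j. \<exists>l. val_tendsto (\<lambda>n. X n $ j) l"
    using complete unfolding val_complete_def by blast
  then obtain l where l: "\<And>j. val_tendsto (\<lambda>n. X n $ j) (l j)" by metis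
  define L where "L = (\<chi> j. l j)"
  have lim: "ereal (real n * \<rho>) \<le> val (X n $ j - L $ j)" for n j
  proof -
    obtain N where N: "\<And>m. N \<le> m \<Longrightarrow> ereal (real n * \<rho>) < val (X m $ j - L $ j)"
      using l[of j] unfolding val_tendsto_def L_def by auto
    have "ereal (real n * \<rho>) \<le> val ((X (max n N) $ j - L $ j) - (X (max n N) $ j - X n $ j))"
      using N[of "max n N"] by (intro val_diff_ge[of _ "_ - _" "_ - _"] far) auto
    then show ?thesis by simp
  qed
  have L_S: "L \<in> S"
    unfolding S_def
  proof (clarify)
    fix j
    have "ereal \<rho> \<le> val ((X 1 $ j - a $ j) - (X 1 $ j - L $ j))"
      using X_S[of 1] lim[of 1 j] by (intro val_diff_ge[of _ "_ - _" "_ - _"]) (auto simp: S_def)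
    then show "ereal \<rho> \<le> val (L $ j - a $ j)" by simp
  qed
  have "\<phi> L = L"
  proof (rule eqI)
    fix n j
    have "ereal (real n * \<rho> + \<rho>) \<le> val (X (Suc n) $ j - \<phi> L $ j)"
      using contraction[OF X_S L_S lim] by (simp add: X_def)
    moreover have "ereal (real n * \<rho> + \<rho>) \<le> val (X (Suc n) $ j - L $ j)"
      using lim[of "Suc n" j] by (simp add: algebra_simps)
    ultimately have "ereal (real n * \<rho> + \<rho>) \<le> val ((X (Suc n) $ j - L $ j) - (X (Suc n) $ j - \<phi> L $ j))"
      by (intro val_diff_ge[of _ "_ - _" "_ - _"])
    moreover have "ereal (real n * \<rho>) \<le> ereal (real n * \<rho> + \<rho>)" using \<rho> by simp
    ultimately show "ereal (real n * \<rho>) \<le> val (\<phi> L $ j - L $ j)"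
      by (simp del: ereal_less_eq)
  qed
  moreover have "x = y" if "x \<in> S" "\<phi> x = x" "y \<in> S" "\<phi> y = y" for x y
  proof (rule eqI)
    fix n j
    show "ereal (real n * \<rho>) \<le> val (x $ j - y $ j)"
    proof (induction n arbitrary: j)
      case 0
      then show ?case using in_S that by simp
    next
      case (Suc n)
      then show ?case using contraction[OF that(1,3) Suc, of j] that by (simp add: algebra_simps)
    qed
  qed
  ultimately show ?thesis using L_S by blast
qed


section \<open>Hensel lifting for systems of Laurent polynomials\<close>

lemma residue_class_matrix_mult:
  fixes A B :: "'a::discretely_valued_field ^ 'n ^ 'n"
  assumes "\<And>i j. 0 \<le> val (A $ i $ j)" "\<And>i j. 0 \<le> val (B $ i $ j)"
  shows "residue_class ((A ** B) $ i $ j) =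
    ((\<chi> i j. residue_class (A $ i $ j)) ** (\<chi> i j. residue_class (B $ i $ j))) $ i $ j"
  by (simp add: matrix_matrix_mult_def residue_class_sum residue_class_mult val_mult_ge_left assms)

lemma val_matrix_vector_mult_ge:
  fixes A :: "'a::discretely_valued_field ^ 'n ^ 'm"
  assumes "\<And>i j. s \<le> val (A $ i $ j)" "\<And>j. t \<le> val (x $ j)"
  shows "s + t \<le> val ((A *v x) $ i)"
  unfolding matrix_vector_mult_def by (simp add: val_sum_ge val_mult_ge assms)

text \<open>The multivariate Hensel lemma. The Jacobian matrix is inverted over the residue field only:
a lift \<open>B\<close> of the inverse suffices both for the contraction and for recovering zeros from
fixed points.\<close>

lemma hensel_laurent_system:
  fixes p :: "'a::discretely_valued_field" and G :: "('n::finite, 'a) laurent ^ 'n"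
  defines "G' \<equiv> \<chi> i. reduce_laurent (G $ i)"
  assumes complete: "val_complete TYPE('a)" and p: "uniformizer p"
    and int: "\<And>i. integral_laurent (G $ i)"
    and zero: "\<xi> \<in> torus_zeros G'" and nondeg: "det (laurent_jacobian G' \<xi>) \<noteq> 0"
  shows "\<exists>!x. x \<in> torus_zeros G \<and> (\<forall>i. val (x $ i) = 0) \<and> reduce_vec x = \<xi>"
proof -
  obtain \<rho> where \<rho>: "0 < \<rho>" "\<And>x :: 'a. 0 < val x \<Longrightarrow> ereal \<rho> \<le> val x"
    by (rule uniformizer_val[OF p]) blast
  have small: "ereal \<rho> \<le> val (x - y)"
    if "0 \<le> val x" "0 \<le> val y" "residue_class x = residue_class y" for x y :: 'a
    using that residue_class_eq_iff \<rho>(2) by blast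
  have "\<forall>i. \<exists>x :: 'a. 0 \<le> val x \<and> residue_class x = \<xi> $ i"
    using residue_class_surj by metis
  then obtain a' where a': "\<And>i. 0 \<le> val (a' i :: 'a)" "\<And>i. residue_class (a' i) = \<xi> $ i" by metis
  define a :: "'a ^ 'n" where "a = (\<chi> i. a' i)"
  have a: "val (a $ i) = 0" "residue_class (a $ i) = \<xi> $ i" for i
    using a'[of i] zero residue_class_ne_0_iff[of "a' i"] by (auto simp: a_def torus_zeros_def)
  define S where "S = {x. \<forall>j. ereal \<rho> \<le> val (x $ j - a $ j)}"
  \<comment> \<open>The disc of radius \<open>\<rho>\<close> around \<open>a\<close> consists of all lifts of \<open>\<xi>\<close>.\<close>
  have S_iff: "x \<in> S \<longleftrightarrow> (\<forall>i. val (x $ i) = 0) \<and> reduce_vec x = \<xi>" for x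
  proof
    assume x: "x \<in> S"
    have pos: "0 < val (x $ i - a $ i)" for i
      using x \<rho>(1) less_le_trans[of 0 "ereal \<rho>" "val (x $ i - a $ i)"] by (auto simp: S_def)
    then have "val (x $ i) = 0" for i
      using a by (auto intro: val_add_eq_0_if_small)
    then show "(\<forall>i. val (x $ i) = 0) \<and> reduce_vec x = \<xi>"
      using a pos by (auto simp: vec_eq_iff residue_class_eq_iff[symmetric])
  next
    assume "(\<forall>i. val (x $ i) = 0) \<and> reduce_vec x = \<xi>"
    then show "x \<in> S"
      using a by (auto simp: S_def vec_eq_iff intro!: small)
  qed
  define ev where "ev x = (\<chi> i. laurent_eval (G $ i) x)" for x
  have ev_small: "ereal \<rho> \<le> val (ev x $ i)" if "x \<in> S" for x i
  proof -
    have x: "\<And>i. val (x $ i) = 0" "reduce_vec x = \<xi>" using that S_iff by auto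
    have "residue_class (laurent_eval (G $ i) x) = 0"
      using zero by (simp add: residue_class_laurent_eval[OF int x(1)] x(2) torus_zeros_def G'_def)
    moreover have "0 \<le> val (laurent_eval (G $ i) x)"
      unfolding laurent_eval_def using int x by (intro val_sum_ge val_mult_ge_left) (auto simp: val_unit_prod_powi)
    ultimately show ?thesis using small[of "ev x $ i" 0] by (simp add: ev_def)
  qed

  define M where "M = laurent_jacobian G a"
  have M: "0 \<le> val (M $ i $ j)" for i j
    by (simp add: M_def laurent_jacobian_def val_laurent_eval_pderiv_ge int a)
  have M': "(\<chi> i j. residue_class (M $ i $ j)) = laurent_jacobian G' \<xi>"
    using a by (simp add: M_def laurent_jacobian_def residue_class_laurent_eval_pderiv int G'_def vec_eq_iff)
  obtain B' where B': "laurent_jacobian G' \<xi> ** B' = mat 1" "B' ** laurent_jacobian G' \<xi> = mat 1"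
    using nondeg unfolding invertible_det_nz[symmetric] invertible_def by blast
  have "\<forall>i j. \<exists>x :: 'a. 0 \<le> val x \<and> residue_class x = B' $ i $ j"
    using residue_class_surj by metis
  then obtain b where b: "\<And>i j. 0 \<le> val (b i j :: 'a)" "\<And>i j. residue_class (b i j) = B' $ i $ j"
    by metis
  define B :: "'a ^ 'n ^ 'n" where "B = (\<chi> i j. b i j)"
  have B: "0 \<le> val (B $ i $ j)" for i j using b by (simp add: B_def)
  have Bres: "(\<chi> i j. residue_class (B $ i $ j)) = B'" using b by (simp add: B_def vec_eq_iff)
  have one: "residue_class ((mat 1 :: 'a ^ 'n ^ 'n) $ i $ j) = mat 1 $ i $ j"
    "0 \<le> val ((mat 1 :: 'a ^ 'n ^ 'n) $ i $ j)" for i j :: 'n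
    by (simp_all add: mat_def)
  have near_one: "ereal \<rho> \<le> val ((mat 1 - C ** D) $ i $ j)"
    if "\<And>i j. 0 \<le> val (C $ i $ j)" "\<And>i j. 0 \<le> val (D $ i $ j)"
      "(\<chi> i j. residue_class (C $ i $ j)) ** (\<chi> i j. residue_class (D $ i $ j)) = mat 1"
    for C D :: "'a ^ 'n ^ 'n" and i j
    unfolding vector_minus_component
  proof (rule small)
    show "0 \<le> val ((C ** D) $ i $ j)"
      unfolding matrix_matrix_mult_def using that by (simp add: val_sum_ge val_mult_ge_left)
  qed (simp_all add: one residue_class_matrix_mult that)
  have BM: "ereal \<rho> \<le> val ((mat 1 - B ** M) $ i $ j)" and MB: "ereal \<rho> \<le> val ((mat 1 - M ** B) $ i $ j)" for i j
    by (intro near_one B M; simp add: M' Bres B')+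

  \<comment> \<open>Newton iteration with the inverse Jacobian kept fixed.\<close>
  define \<phi> where "\<phi> x = x - B *v ev x" for x
  have maps: "\<phi> x \<in> S" if "x \<in> S" for x
    unfolding S_def
  proof (clarify)
    fix j
    have "ereal \<rho> \<le> val ((B *v ev x) $ j)"
      using val_matrix_vector_mult_ge[of 0 B "ereal \<rho>"] B ev_small[OF that] by simp
    moreover have "ereal \<rho> \<le> val (x $ j - a $ j)" using that by (simp add: S_def)
    ultimately have "ereal \<rho> \<le> val ((x $ j - a $ j) - (B *v ev x) $ j)" by (rule val_diff_ge[rotated])
    then show "ereal \<rho> \<le> val (\<phi> x $ j - a $ j)" by (simp add: \<phi>_def algebra_simps)
  qed
  have contraction: "ereal (r + \<rho>) \<le> val (\<phi> x $ j - \<phi> y $ j)"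
    if "x \<in> S" "y \<in> S" and r: "\<And>i. ereal r \<le> val (x $ i - y $ i)" for x y r j
  proof -
    define e where "e = ev x - ev y - M *v (x - y)"
    have e: "ereal (r + \<rho>) \<le> val (e $ i)" for i
      using expands_laurent_eval[of "G $ i" a "ereal \<rho>" x y "ereal r"] that int a \<rho>(1)
      by (simp add: e_def ev_def M_def S_def expands_def laurent_jacobian_def matrix_vector_mult_def)
    \<comment> \<open>The first summand gains \<open>\<rho>\<close> from the matrix, the second from the Taylor error.\<close>
    have "\<phi> x - \<phi> y = (mat 1 - B ** M) *v (x - y) - B *v e"
      by (simp add: \<phi>_def e_def matrix_vector_mult_diff_rdistrib matrix_vector_mult_diff_distrib
          matrix_vector_mul_assoc algebra_simps)
    then have "\<phi> x $ j - \<phi> y $ j = ((mat 1 - B ** M) *v (x - y)) $ j - (B *v e) $ j"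
      by (metis vector_minus_component)
    moreover have "ereal (r + \<rho>) \<le> val (((mat 1 - B ** M) *v (x - y)) $ j)"
      using val_matrix_vector_mult_ge[OF BM, of "ereal r" "x - y" j] r by (simp add: add.commute)
    moreover have "ereal (r + \<rho>) \<le> val ((B *v e) $ j)"
      using val_matrix_vector_mult_ge[of 0 B "ereal (r + \<rho>)" e j] B e by simp
    ultimately show ?thesis using val_diff_ge by simp
  qed
  have "\<exists>!x. x \<in> S \<and> \<phi> x = x"
    unfolding S_def
  proof (rule ultrametric_fixed_point[OF complete \<rho>(1)], fold S_def)
    show "\<phi> x \<in> S" if "x \<in> S" for x using maps that .
    show "ereal (r + \<rho>) \<le> val (\<phi> x $ j - \<phi> y $ j)"
      if "x \<in> S" "y \<in> S" "\<And>i. ereal r \<le> val (x $ i - y $ i)" for x y r j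
      using contraction that .
  qed
  moreover have "\<phi> x = x \<longleftrightarrow> ev x = 0" if "x \<in> S" for x
  proof
    assume "\<phi> x = x"
    then have Bg: "B *v ev x = 0" by (simp add: \<phi>_def)
    \<comment> \<open>Although \<open>B\<close> need not be an exact inverse, it is injective: a vector killed by \<open>B\<close>
      is fixed by \<open>mat 1 - M ** B\<close>, which raises every lower bound on its valuations by \<open>\<rho>\<close>.\<close>
    have g: "(mat 1 - M ** B) *v ev x = ev x"
      by (simp add: matrix_vector_mult_diff_rdistrib matrix_vector_mul_assoc[symmetric] Bg)
    have bound: "ereal (real n * \<rho>) \<le> val (ev x $ i)" for n i
    proof (induction n arbitrary: i)
      case 0
      have "ereal 0 \<le> ereal \<rho>" using \<rho>(1) by simp
      from order_trans[OF this ev_small[OF that]] show ?case by simp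
    next
      case (Suc n)
      have "ereal \<rho> + ereal (real n * \<rho>) \<le> val (((mat 1 - M ** B) *v ev x) $ i)"
        by (rule val_matrix_vector_mult_ge[OF MB Suc])
      then show ?case unfolding g by (simp add: algebra_simps)
    qed
    show "ev x = 0"
    proof (rule vec_eq_iff[THEN iffD2], rule allI, rule eq_if_val_unbounded)
      fix i and C :: real
      obtain n where "C < real n * \<rho>" using reals_Archimedean3[OF \<rho>(1)] by blast
      then show "ereal C \<le> val (ev x $ i - 0 $ i)"
        using bound[of n i] order_trans[of "ereal C" "ereal (real n * \<rho>)"] by simp
    qed
  qed (simp add: \<phi>_def)
  moreover have "x \<in> torus_zeros G \<and> (\<forall>i. val (x $ i) = 0) \<and> reduce_vec x = \<xi> \<longleftrightarrow> x \<in> S \<and> ev x = 0" for x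
  proof -
    have "x $ i \<noteq> 0" if "val (x $ i) = 0" for i using that by auto
    then show ?thesis by (auto simp: S_iff torus_zeros_def ev_def vec_eq_iff)
  qed
  ultimately show ?thesis by (simp cong: conj_cong)
qed


section \<open>Rescaling a point of the tropical lattice to the origin\<close>

lemma lookup_sum_single:
  assumes "finite S"
  shows "Poly_Mapping.lookup (\<Sum>\<alpha>\<in>S. Poly_Mapping.single \<alpha> (c \<alpha>)) \<beta> = (if \<beta> \<in> S then c \<beta> else 0)"
  using assms by (simp add: lookup_sum lookup_single when_def)

lemma finite_min_exponents: "finite (min_exponents f w)"
  by (simp add: min_exponents_def)

lemma lookup_initial_form:
  "Poly_Mapping.lookup (initial_form p w f) \<alpha> =
    (if \<alpha> \<in> min_exponents f w then first_digit p (Poly_Mapping.lookup f \<alpha>) else 0)"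
  by (simp add: initial_form_def lookup_sum_single finite_min_exponents)

lemma lookup_lower_poly:
  "Poly_Mapping.lookup (lower_poly w f) \<alpha> =
    (if \<alpha> \<in> min_exponents f w then Poly_Mapping.lookup f \<alpha> else 0)"
  by (simp add: lower_poly_def lookup_sum_single finite_min_exponents)

lemma trop_fun_le: "\<alpha> \<in> Poly_Mapping.keys f \<Longrightarrow> trop_fun f w \<le> trop_linear f \<alpha> w"
  by (simp add: trop_fun_def)

lemma trop_fun_attained:
  assumes "f \<noteq> 0"
  obtains \<alpha> where "\<alpha> \<in> Poly_Mapping.keys f" "trop_linear f \<alpha> w = trop_fun f w"
proof -
  have "trop_fun f w \<in> (\<lambda>\<alpha>. trop_linear f \<alpha> w) ` Poly_Mapping.keys f"
    unfolding trop_fun_def using assms by (intro Min_in) auto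
  then show ?thesis using that by auto
qed

text \<open>All exponents of the lower polynomial take the minimal value at \<open>w\<close>, so they all stay minimal,
with unchanged coefficients.\<close>

lemma initial_form_lower_poly:
  assumes "f \<noteq> 0"
  shows "lower_poly w f \<noteq> 0" "initial_form p w (lower_poly w f) = initial_form p w f"
proof -
  obtain \<alpha> where \<alpha>: "\<alpha> \<in> Poly_Mapping.keys f" "trop_linear f \<alpha> w = trop_fun f w"
    by (rule trop_fun_attained[OF assms])
  have keys: "Poly_Mapping.keys (lower_poly w f) = min_exponents f w"
    by (auto simp: in_keys_iff lookup_lower_poly min_exponents_def split: if_splits)
  have ne: "min_exponents f w \<noteq> {}" using \<alpha> by (auto simp: min_exponents_def)
  then show "lower_poly w f \<noteq> 0" using keys by auto
  have lin: "trop_linear (lower_poly w f) \<beta> w = trop_fun f w" if "\<beta> \<in> min_exponents f w" for \<beta>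
    using that by (simp add: trop_linear_def lookup_lower_poly) (simp add: min_exponents_def trop_linear_def)
  have "(\<lambda>\<beta>. trop_linear (lower_poly w f) \<beta> w) ` min_exponents f w = {trop_fun f w}"
    using ne lin by auto
  then have "trop_fun (lower_poly w f) w = trop_fun f w"
    unfolding trop_fun_def[of "lower_poly w f"] keys by simp
  then have "min_exponents (lower_poly w f) w = min_exponents f w"
    using lin by (auto simp: min_exponents_def[of "lower_poly w f"] keys)
  then show "initial_form p w (lower_poly w f) = initial_form p w f"
    by (intro poly_mapping_eqI) (simp add: lookup_initial_form lookup_lower_poly)
qed

text \<open>\<open>rescale p m c f\<close> is \<open>p ^ (-c) f(p ^ m\<^sub>1 Y\<^sub>1, \<dots>, p ^ m\<^sub>n Y\<^sub>n)\<close>, as \<open>laurent_eval_scale_point\<close> shows.\<close>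

definition rescale :: "'a \<Rightarrow> int ^ 'n \<Rightarrow> int \<Rightarrow> ('n::finite, 'a::field) laurent \<Rightarrow> ('n, 'a) laurent" where
  "rescale p m c = Poly_Mapping.mapp (\<lambda>\<alpha> a. p powi ((\<Sum>i\<in>UNIV. \<alpha> $ i * m $ i) - c) * a)"

definition scale_point :: "'a::field \<Rightarrow> int ^ 'n \<Rightarrow> 'a ^ 'n \<Rightarrow> 'a ^ 'n" where
  "scale_point p m y = (\<chi> i. p powi (m $ i) * y $ i)"

lemma lookup_rescale: "Poly_Mapping.lookup (rescale p m c f) \<alpha> =
    p powi ((\<Sum>i\<in>UNIV. \<alpha> $ i * m $ i) - c) * Poly_Mapping.lookup f \<alpha>"
  by (auto simp: rescale_def lookup_mapp when_def in_keys_iff)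

lemma powi_sum:
  assumes "(p :: 'a::field) \<noteq> 0"
  shows "(\<Prod>i\<in>S. p powi (k i)) = p powi (\<Sum>i\<in>S. k i)"
  using assms by (induction S rule: infinite_finite_induct) (auto simp: power_int_add)

lemma laurent_eval_scale_point:
  assumes "(p :: 'a::field) \<noteq> 0"
  shows "laurent_eval f (scale_point p m y) = p powi c * laurent_eval (rescale p m c f) y"
proof -
  have sub: "Poly_Mapping.keys (rescale p m c f) \<subseteq> Poly_Mapping.keys f"
    by (auto simp: in_keys_iff lookup_rescale)
  have "(\<Prod>i\<in>UNIV. (scale_point p m y $ i) powi (\<alpha> $ i)) =
      p powi (\<Sum>i\<in>UNIV. \<alpha> $ i * m $ i) * (\<Prod>i\<in>UNIV. (y $ i) powi (\<alpha> $ i))" for \<alpha>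
    by (simp add: scale_point_def power_int_mult_distrib prod.distrib power_int_mult[symmetric]
        powi_sum[OF assms] mult.commute)
  moreover have "p powi c * (p powi (k - c) * a * z) = a * (p powi k * z)" for k a z
    using assms by (simp add: power_int_diff)
  ultimately show ?thesis
    unfolding laurent_eval_superset[OF finite_keys sub] lookup_rescale
    by (simp only: laurent_eval_def sum_distrib_left)
qed

lemma first_digit_val:
  assumes "val p = ereal \<rho>" "0 < \<rho>" "val x = ereal (\<rho> * of_int k)"
  shows "first_digit p x = residue_class (p powi (- k) * x)"
  using assms by (simp add: first_digit_def)

lemma trop_fun_integral:
  fixes f :: "('n::finite, 'a::discretely_valued_field) laurent" and p :: 'a
  assumes \<rho>: "val p = ereal \<rho>" "0 < \<rho>" "\<And>x :: 'a. 0 < val x \<Longrightarrow> ereal \<rho> \<le> val x"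
    and w: "\<And>i. w $ i = \<rho> * of_int (m $ i)" and "f \<noteq> 0"
  shows "\<exists>c::int. trop_fun f w = \<rho> * of_int c"
proof -
  obtain \<alpha> where \<alpha>: "\<alpha> \<in> Poly_Mapping.keys f" "trop_linear f \<alpha> w = trop_fun f w"
    by (rule trop_fun_attained[OF \<open>f \<noteq> 0\<close>])
  obtain k where "val (Poly_Mapping.lookup f \<alpha>) = ereal (\<rho> * of_int k)"
    using uniformizer_val_integral[OF \<rho>] \<alpha>(1) by (metis in_keys_iff)
  then have "trop_fun f w = \<rho> * of_int (k + (\<Sum>i\<in>UNIV. \<alpha> $ i * m $ i))"
    unfolding \<alpha>(2)[symmetric] by (simp add: trop_linear_def w sum_distrib_left algebra_simps)
  then show ?thesis by blast
qed

text \<open>The valuation of a coefficient of the rescaled polynomial is the excess of the linear form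
of its exponent over the tropical value \<open>\<rho> c\<close>; hence it is nonnegative, and zero exactly at the
minimal exponents. There the power of \<open>p\<close> introduced by rescaling is the one that
extracts the first digit.\<close>

lemma rescale_reduces_to_initial_form:
  fixes f :: "('n::finite, 'a::discretely_valued_field) laurent" and p :: 'a
  assumes \<rho>: "val p = ereal \<rho>" "0 < \<rho>" "\<And>x :: 'a. 0 < val x \<Longrightarrow> ereal \<rho> \<le> val x"
    and w: "\<And>i. w $ i = \<rho> * of_int (m $ i)" and c: "trop_fun f w = \<rho> * of_int c"
  shows "integral_laurent (rescale p m c f)"
    and "reduce_laurent (rescale p m c f) = initial_form p w f"
proof -
  let ?s = "\<lambda>\<alpha>. \<Sum>i\<in>UNIV. \<alpha> $ i * m $ i"
  have v: "val (Poly_Mapping.lookup (rescale p m c f) \<alpha>) = ereal (trop_linear f \<alpha> w - trop_fun f w)"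
    if "\<alpha> \<in> Poly_Mapping.keys f" for \<alpha>
  proof -
    have "Poly_Mapping.lookup f \<alpha> \<noteq> 0" using that by (simp add: in_keys_iff)
    then obtain r where r: "val (Poly_Mapping.lookup f \<alpha>) = ereal r" by (rule val_finite)
    show ?thesis
      by (simp add: lookup_rescale val_mult val_powi[OF \<rho>(1)] r trop_linear_def c w
          sum_distrib_left algebra_simps)
  qed
  have zero: "Poly_Mapping.lookup (rescale p m c f) \<alpha> = 0" if "\<alpha> \<notin> Poly_Mapping.keys f" for \<alpha>
    using that by (simp add: lookup_rescale in_keys_iff)
  show int: "integral_laurent (rescale p m c f)"
  proof
    fix \<alpha>
    show "0 \<le> val (Poly_Mapping.lookup (rescale p m c f) \<alpha>)"
      using v[of \<alpha>] zero[of \<alpha>] trop_fun_le[of \<alpha> f w] by (cases "\<alpha> \<in> Poly_Mapping.keys f") auto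
  qed
  show "reduce_laurent (rescale p m c f) = initial_form p w f"
  proof (rule poly_mapping_eqI)
    fix \<alpha>
    show "Poly_Mapping.lookup (reduce_laurent (rescale p m c f)) \<alpha> =
      Poly_Mapping.lookup (initial_form p w f) \<alpha>"
    proof (cases "\<alpha> \<in> min_exponents f w")
      case True
      then have \<alpha>: "Poly_Mapping.lookup f \<alpha> \<noteq> 0" "trop_linear f \<alpha> w = \<rho> * of_int c"
        by (auto simp: min_exponents_def in_keys_iff c)
      obtain k where k: "val (Poly_Mapping.lookup f \<alpha>) = ereal (\<rho> * of_int k)"
        using uniformizer_val_integral[OF \<rho> \<alpha>(1)] by blast
      have "\<rho> * of_int (k + ?s \<alpha>) = \<rho> * of_int c"
        using \<alpha>(2) by (simp add: trop_linear_def k w sum_distrib_left algebra_simps)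
      then have "k + ?s \<alpha> = c" using \<rho>(2) by (simp del: of_int_add)
      \<comment> \<open>At a minimal exponent the rescaling factor turns the coefficient into a unit.\<close>
      then have "?s \<alpha> - c = - k" by simp
      then show ?thesis
        using True by (simp add: lookup_reduce_laurent lookup_rescale lookup_initial_form
            first_digit_val[OF \<rho>(1,2) k])
    next
      case False
      then have "0 < val (Poly_Mapping.lookup (rescale p m c f) \<alpha>)"
        using v[of \<alpha>] zero[of \<alpha>] trop_fun_le[of \<alpha> f w]
        by (cases "\<alpha> \<in> Poly_Mapping.keys f") (auto simp: min_exponents_def)
      then show ?thesis
        using False by (simp add: lookup_reduce_laurent lookup_initial_form residue_class_eq_0_iff)
    qed
  qed
qed


section \<open>The first digit bijection\<close>

text \<open>The nondegeneracy hypothesis concerns the initial system only. As \<open>F\<close> and its lower system share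
it, the result applies to both.\<close>

theorem first_digit_bij_betw:
  fixes p :: "'a::discretely_valued_field" and F :: "('n::finite, 'a) laurent ^ 'n"
  assumes complete: "val_complete TYPE('a)" and p: "uniformizer p"
    and nz: "\<And>i. F $ i \<noteq> 0" and w: "w \<in> val_lattice p"
    and nondeg: "\<not> (\<exists>\<xi>. degenerate_zero (initial_system p w F) \<xi>)"
  shows "bij_betw (first_digit_vec p) (torus_zeros_at F w) (torus_zeros (initial_system p w F))"
proof -
  obtain \<rho> where \<rho>: "val p = ereal \<rho>" "0 < \<rho>" "\<And>x :: 'a. 0 < val x \<Longrightarrow> ereal \<rho> \<le> val x"
    by (rule uniformizer_val[OF p]) blast
  then have "p \<noteq> 0" by auto
  obtain m :: "int ^ 'n" where m: "\<And>i. w $ i = \<rho> * of_int (m $ i)"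
    using w \<rho>(1) by (auto simp: val_lattice_def)
  have "\<forall>i. \<exists>c::int. trop_fun (F $ i) w = \<rho> * of_int c"
    using trop_fun_integral[OF \<rho> m nz] by blast
  then obtain c where c: "\<And>i. trop_fun (F $ i) w = \<rho> * of_int (c i)" by metis
  define G where "G = (\<chi> i. rescale p m (c i) (F $ i))"
  have int: "integral_laurent (G $ i)" for i
    unfolding G_def using rescale_reduces_to_initial_form(1)[OF \<rho> m c] by simp
  have red: "initial_system p w F = (\<chi> i. reduce_laurent (G $ i))"
    using rescale_reduces_to_initial_form(2)[OF \<rho> m c] by (simp add: G_def initial_system_def)
  define U where "U = {y \<in> torus_zeros G. \<forall>i. val (y $ i) = 0}"

  \<comment> \<open>Hensel lifting in the rescaled coordinates.\<close>
  have "bij_betw reduce_vec U (torus_zeros (initial_system p w F))"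
    unfolding bij_betw_def inj_on_def
  proof (intro conjI set_eqI iffI ballI impI)
    have into: "reduce_vec y \<in> torus_zeros (initial_system p w F)" if "y \<in> U" for y
    proof -
      have y: "\<And>i. val (y $ i) = 0" "y \<in> torus_zeros G" using that by (auto simp: U_def)
      have "laurent_eval (reduce_laurent (G $ i)) (reduce_vec y) = 0" for i
        using y(2) residue_class_laurent_eval[OF int y(1), of i] by (simp add: torus_zeros_def)
      then show ?thesis
        using y residue_class_ne_0_iff[of "y $ i" for i] by (simp add: torus_zeros_def red)
    qed
    have lift: "\<exists>!y. y \<in> U \<and> reduce_vec y = \<xi>" if "\<xi> \<in> torus_zeros (initial_system p w F)" for \<xi>
      using hensel_laurent_system[OF complete p int, of \<xi>] that nondeg
      by (auto simp: red U_def degenerate_zero_def conj_assoc)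
    show "x = y" if "x \<in> U" "y \<in> U" "reduce_vec x = reduce_vec y" for x y
      using lift[OF into[OF that(1)]] that by metis
    show "\<xi> \<in> torus_zeros (initial_system p w F)" if "\<xi> \<in> reduce_vec ` U" for \<xi>
      using that into by blast
    show "\<xi> \<in> reduce_vec ` U" if "\<xi> \<in> torus_zeros (initial_system p w F)" for \<xi>
      using lift[OF that] by blast
  qed
  moreover have "first_digit_vec p (scale_point p m y) = reduce_vec y" if "y \<in> U" for y
  proof -
    have v: "val (scale_point p m y $ i) = ereal (\<rho> * of_int (m $ i))" for i
      using that by (simp add: scale_point_def U_def val_mult val_powi[OF \<rho>(1)] mult.commute)
    have "p powi - k * (p powi k * z) = z" for k z
      using \<open>p \<noteq> 0\<close> by (simp add: power_int_minus)
    then show ?thesis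
      unfolding first_digit_vec_def first_digit_val[OF \<rho>(1,2) v]
      by (simp only: scale_point_def vec_lambda_beta)
  qed
  ultimately have comp: "bij_betw (first_digit_vec p \<circ> scale_point p m) U (torus_zeros (initial_system p w F))"
    using bij_betw_cong[of U "first_digit_vec p \<circ> scale_point p m" reduce_vec] by simp
  have ev: "laurent_eval (F $ i) (scale_point p m y) = p powi (c i) * laurent_eval (G $ i) y" for i y
    unfolding G_def using laurent_eval_scale_point[OF \<open>p \<noteq> 0\<close>] by simp
  have inv1: "scale_point p (- m) (scale_point p m y) = y" and inv2: "scale_point p m (scale_point p (- m) y) = y" for y
    using \<open>p \<noteq> 0\<close> by (simp_all add: scale_point_def vec_eq_iff power_int_minus)
  have mem: "scale_point p m y \<in> torus_zeros_at F w \<longleftrightarrow> y \<in> U" for y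
  proof -
    have "val (scale_point p m y $ i) = ereal (w $ i) \<longleftrightarrow> val (y $ i) = 0" for i
      by (cases "val (y $ i)") (simp_all add: scale_point_def val_mult val_powi[OF \<rho>(1)] m mult.commute zero_ereal_def)
    moreover have "scale_point p m y $ i \<noteq> 0 \<longleftrightarrow> y $ i \<noteq> 0" for i
      using \<open>p \<noteq> 0\<close> by (simp add: scale_point_def)
    ultimately show ?thesis
      using \<open>p \<noteq> 0\<close> by (simp add: torus_zeros_at_def torus_zeros_def U_def ev)
  qed
  have "scale_point p (- m) x \<in> U" if "x \<in> torus_zeros_at F w" for x
    using that by (simp add: mem[symmetric] inv2)
  then have "bij_betw (scale_point p m) U (torus_zeros_at F w)"
    by (intro bij_betwI[where g = "scale_point p (- m)"]) (auto simp: inv1 inv2 mem)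
  from bij_betw_comp_iff[OF this] comp show ?thesis by blast
qed

theorem theorem3p11:
  fixes p :: "'a::discretely_valued_field"
    and F :: "('n::finite, 'a) laurent ^ 'n"
    and w :: "real ^ 'n"
  assumes "val_complete TYPE('a)"
    and "uniformizer p"
    and "\<forall>i. F $ i \<noteq> 0"
    and "w \<in> Trop_system F \<inter> val_lattice p"
    and "semiregular_at p F w"
  shows "bij_betw (first_digit_vec p) (torus_zeros_at F w) (torus_zeros (initial_system p w F)) \<and>
         bij_betw (first_digit_vec p) (torus_zeros_at (lower_system w F) w)
           (torus_zeros (initial_system p w F))"
proof
  have lattice: "w \<in> val_lattice p" using assms(4) by blast
  have nondeg: "\<not> (\<exists>\<xi>. degenerate_zero (initial_system p w F) \<xi>)"
    using assms(4,5) by (simp add: semiregular_at_def)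
  show "bij_betw (first_digit_vec p) (torus_zeros_at F w) (torus_zeros (initial_system p w F))"
    using assms(3) by (intro first_digit_bij_betw[OF assms(1,2) _ lattice nondeg]) simp
  have same: "initial_system p w (lower_system w F) = initial_system p w F"
    using assms(3) by (simp add: initial_system_def lower_system_def initial_form_lower_poly(2))
  have "bij_betw (first_digit_vec p) (torus_zeros_at (lower_system w F) w)
      (torus_zeros (initial_system p w (lower_system w F)))"
  proof (rule first_digit_bij_betw[OF assms(1,2) _ lattice])
    show "lower_system w F $ i \<noteq> 0" for i
      using assms(3) by (simp add: lower_system_def initial_form_lower_poly(1))
    show "\<not> (\<exists>\<xi>. degenerate_zero (initial_system p w (lower_system w F)) \<xi>)"
      using nondeg unfolding same .
  qed
  then show "bij_betw (first_digit_vec p) (torus_zeros_at (lower_system w F) w)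
      (torus_zeros (initial_system p w F))"
    by (simp add: same)
qed

end
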